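(* For every integer $n\geq 1$, the set $\mathrm{flat}(\mathcal{Q}_{n+1})$ of flattened Stirling permutations of order $n+1$ is in bijection with the set $\Pi^B_n$ of type $B$ set partitions of the interval of integers $[-n,n]$.
   Context: A Stirling permutation of order $N$ is a word $w=w_1w_2\cdots w_{2N}$ in which every letter of $\{1,\dots,N\}$ appears exactly twice and such that, for each $i$, every letter appearing between the two occurrences of $i$ is greater than $i$. $\mathcal{Q}_N$ is the set of Stirling permutations of order $N$. The runs of $w\in\mathcal{Q}_N$ are its maximal contiguous weakly increasing subwords. $w$ is flattened if the sequence of leading (first) terms of its runs, read from left to right, is weakly increasing. $\mathrm{flat}(\mathcal{Q}_N)$ is the set of flattened elements of $\mathcal{Q}_N$. Here $[-n,n]$ denotes the set of integers from $-n$ to $n$. A type $B$ set partition of $[-n,n]$ is a collection $\mathcal{B}$ of pairwise disjoint subsets (blocks) of $[-n,n]$ whose union is $[-n,n]$, such that (i) if $\beta\in\mathcal{B}$ then $-\beta:=\{-b: b\in\beta\}\in\mathcal{B}$, and (ii) there is exactly one block $\beta\in\mathcal{B}$ with $\beta=-\beta$ (this block contains $0$ and is called the zero-block). $\Pi^B_n$ is the set of all type $B$ set partitions of $[-n,n]$. *)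

theory Defs
  imports Main "HOL-Library.Disjoint_Sets"
begin

definition stirling_perms :: "nat \<Rightarrow> nat list set" where
  "stirling_perms N = {w. set w \<subseteq> {1..N} \<and> (\<forall>i\<in>{1..N}. count_list w i = 2) \<and>
     (\<forall>a k b. a < k \<and> k < b \<and> b < length w \<and> w ! a = w ! b \<longrightarrow> w ! a < w ! k)}"

text \<open>The contiguous subword of \<open>w\<close> occupying the (0-based) positions \<open>i, \<dots>, j\<close>.\<close>

definition subword :: "'a list \<Rightarrow> nat \<Rightarrow> nat \<Rightarrow> 'a list" where
  "subword w i j = take (Suc j - i) (drop i w)"

text \<open>Runs are represented by the pair of their first and last positions, so that equal
  subwords at different places remain distinct.\<close>

definition is_run :: "'a::linorder list \<Rightarrow> nat \<Rightarrow> nat \<Rightarrow> bool" where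
  "is_run w i j \<longleftrightarrow> i \<le> j \<and> j < length w \<and> sorted (subword w i j) \<and>
     (\<forall>i' j'. i' \<le> i \<and> j \<le> j' \<and> j' < length w \<and> sorted (subword w i' j') \<longrightarrow> i' = i \<and> j' = j)"

text \<open>Distinct runs start at distinct positions, so selecting the letters at the starting
  positions lists the leading terms of the runs, once each, from left to right.\<close>

definition run_leaders :: "'a::linorder list \<Rightarrow> 'a list" where
  "run_leaders w = nths w {i. \<exists>j. is_run w i j}"

definition flattened :: "'a::linorder list \<Rightarrow> bool" where
  "flattened w \<longleftrightarrow> sorted (run_leaders w)"

definition flat :: "'a::linorder list set \<Rightarrow> 'a list set" where
  "flat A = {w \<in> A. flattened w}"

text \<open>The nonemptiness of blocks required by \<open>partition_on\<close> is no restriction: the empty set and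
  the block containing 0 would be two different blocks equal to their own negatives.\<close>

definition typeB_partitions :: "nat \<Rightarrow> int set set set" where
  "typeB_partitions n = {\<B>. partition_on {- int n..int n} \<B> \<and>
     (\<forall>\<beta>\<in>\<B>. uminus ` \<beta> \<in> \<B>) \<and> (\<exists>!\<beta>. \<beta> \<in> \<B> \<and> uminus ` \<beta> = \<beta>)}"

end

theory Submission
  imports Defs
begin

text \<open>Both families are generated by the same branching process, so they have equally many
  members at each stage; as both are finite, this gives the bijection.

  On the side of words, call a position a right-to-left minimum if its letter is at most every
  later letter. A word is flattened exactly if every position where a run starts is such a
  minimum (\<open>flattened_iff\<close>): every letter is at least the leader of its own run, hence at
  least every earlier leader. In a Stirling permutation the two copies of the largest letter
  \<open>m\<close> are adjacent, so deleting them undoes an insertion of \<open>m m\<close> into a gap of a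
  smaller Stirling permutation \<open>w\<close>. Except at the end of the word, such an insertion makes
  the letter after the gap start a run, so flattenedness survives exactly if the gap is at the end
  or just before a right-to-left minimum; the front is excluded, as \<open>m\<close> itself would become
  a leader. Let \<open>w\<close> have \<open>s\<close> right-to-left minima other than its first position. Then
  it has \<open>s + 1\<close> children. The \<open>s\<close> children obtained at inner gaps have the same
  statistic \<open>s\<close>, since a smaller letter still follows the new ones; appending \<open>m m\<close>
  creates two new right-to-left minima and gives \<open>s + 2\<close>.

  On the side of type B partitions, the pair \<open>{n + 1, -(n + 1)}\<close> can be added to a
  partition with \<open>s\<close> blocks by putting \<open>n + 1\<close> into one of them, and
  \<open>-(n + 1)\<close> into its negative, or by making two new singleton blocks. This again gives
  \<open>s\<close> children with statistic \<open>s\<close> and one with statistic \<open>s + 2\<close>.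

  Both processes start from a single object with statistic 1, namely the word \<open>1 1\<close> and the
  partition of \<open>{0}\<close>. By \<open>card_fibre_succession\<close> the numbers of objects with a given
  statistic satisfy the same recurrence, and these numbers determine the totals.\<close>

section \<open>A common succession rule\<close>

text \<open>Here \<open>C x\<close> holds the labels of the children of \<open>x\<close> that inherit its statistic,
  and \<open>e x\<close> is the label of the one child whose statistic grows by two. A child with
  statistic \<open>r\<close> thus comes from one of the \<open>r\<close> inheriting labels of a parent with
  statistic \<open>r\<close>, or from the growing label of a parent with statistic \<open>r - 2\<close>; the
  latter condition is written additively to avoid truncated subtraction.\<close>

lemma card_fibre_succession:
  fixes ins :: "'a \<Rightarrow> 'c \<Rightarrow> 'b" and s :: "'a \<Rightarrow> nat" and s' :: "'b \<Rightarrow> nat"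
  assumes fin: "finite A"
    and bij: "bij_betw (\<lambda>(x, c). ins x c) (SIGMA x:A. insert (e x) (C x)) A'"
    and C: "\<And>x. x \<in> A \<Longrightarrow> finite (C x) \<and> card (C x) = s x \<and> e x \<notin> C x"
    and keep: "\<And>x c. x \<in> A \<Longrightarrow> c \<in> C x \<Longrightarrow> s' (ins x c) = s x"
    and grow: "\<And>x. x \<in> A \<Longrightarrow> s' (ins x (e x)) = s x + 2"
  shows "finite A' \<and> card {y \<in> A'. s' y = r} =
    r * card {x \<in> A. s x = r} + card {x \<in> A. s x + 2 = r}"
proof
  let ?S = "SIGMA x:A. insert (e x) (C x)"
  let ?K = "SIGMA x:{x \<in> A. s x = r}. C x"
  let ?G = "(\<lambda>x. (x, e x)) ` {x \<in> A. s x + 2 = r}"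
  have "finite ?S" using fin C by auto
  then show "finite A'" using bij bij_betw_finite by blast
  have eq: "{y \<in> A'. s' y = r} = (\<lambda>(x, c). ins x c) ` (?K \<union> ?G)"
  proof (intro equalityI subsetI)
    fix y assume y: "y \<in> {y \<in> A'. s' y = r}"
    then have "y \<in> (\<lambda>(x, c). ins x c) ` ?S" using bij by (simp add: bij_betw_def)
    then obtain x c where "x \<in> A" "c = e x \<or> c \<in> C x" "y = ins x c" by auto
    then have "(x, c) \<in> ?K \<union> ?G" using y keep grow by auto
    then show "y \<in> (\<lambda>(x, c). ins x c) ` (?K \<union> ?G)" using \<open>y = ins x c\<close> by force
  next
    fix y assume "y \<in> (\<lambda>(x, c). ins x c) ` (?K \<union> ?G)"
    then obtain x c where xc: "(x, c) \<in> ?K \<union> ?G" "y = ins x c" by auto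
    then have "(x, c) \<in> ?S" by auto
    then have "y \<in> A'" using bij_betw_apply[OF bij] xc(2) by fastforce
    moreover have "s' y = r" using xc keep grow by auto
    ultimately show "y \<in> {y \<in> A'. s' y = r}" by simp
  qed
  have inj: "inj_on (\<lambda>(x, c). ins x c) (?K \<union> ?G)"
    by (rule inj_on_subset[OF bij_betw_imp_inj_on[OF bij]]) auto
  have "card {y \<in> A'. s' y = r} = card (?K \<union> ?G)"
    unfolding eq by (rule card_image[OF inj])
  also have "\<dots> = card ?K + card ?G"
    by (rule card_Un_disjoint) (use fin C in auto)
  also have "card ?K = r * card {x \<in> A. s x = r}"
    using C fin by (subst card_SigmaI) auto
  also have "card ?G = card {x \<in> A. s x + 2 = r}"
    by (rule card_image) (auto simp: inj_on_def)
  finally show "card {y \<in> A'. s' y = r} =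
    r * card {x \<in> A. s x = r} + card {x \<in> A. s x + 2 = r}" .
qed

lemma card_eq_if_fibres_card_eq:
  assumes "finite A" "finite B"
    and "\<And>r. card {x \<in> A. s x = r} = card {y \<in> B. t y = r}"
  shows "card A = card B"
proof -
  have "card A = (\<Sum>r\<in>s ` A \<union> t ` B. card {x \<in> A. s x = r})"
    using assms sum.group[of A "s ` A \<union> t ` B" s "\<lambda>_. 1::nat"] by simp
  also have "\<dots> = (\<Sum>r\<in>s ` A \<union> t ` B. card {y \<in> B. t y = r})"
    using assms(3) by simp
  also have "\<dots> = card B"
    using assms sum.group[of B "s ` A \<union> t ` B" t "\<lambda>_. 1::nat"] by simp
  finally show ?thesis .
qed

section \<open>Flattened words\<close>

definition rl_min :: "'a::linorder list \<Rightarrow> nat \<Rightarrow> bool" where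
  "rl_min w p \<longleftrightarrow> (\<forall>q. p \<le> q \<and> q < length w \<longrightarrow> w ! p \<le> w ! q)"

text \<open>A run starts at the front of the word and after every descent; \<open>ex_is_run_iff\<close> matches
  this local condition with maximality among the increasing subwords.\<close>

definition run_start :: "'a::linorder list \<Rightarrow> nat \<Rightarrow> bool" where
  "run_start w i \<longleftrightarrow> i < length w \<and> (i = 0 \<or> w ! i < w ! (i - 1))"

lemma sorted_subword_iff:
  assumes "j < length w"
  shows "sorted (subword w i j) \<longleftrightarrow> (\<forall>a b. i \<le> a \<and> a \<le> b \<and> b \<le> j \<longrightarrow> w ! a \<le> w ! b)"
proof
  assume s: "sorted (subword w i j)"
  show "\<forall>a b. i \<le> a \<and> a \<le> b \<and> b \<le> j \<longrightarrow> w ! a \<le> w ! b"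
  proof (intro allI impI)
    fix a b assume ab: "i \<le> a \<and> a \<le> b \<and> b \<le> j"
    have "subword w i j ! (a - i) \<le> subword w i j ! (b - i)"
      using s by (rule sorted_nth_mono) (use ab assms in \<open>auto simp: subword_def\<close>)
    moreover have "a - i < Suc j - i" "b - i < Suc j - i" using ab by linarith+
    ultimately show "w ! a \<le> w ! b" using ab assms by (simp add: subword_def)
  qed
next
  assume "\<forall>a b. i \<le> a \<and> a \<le> b \<and> b \<le> j \<longrightarrow> w ! a \<le> w ! b"
  then show "sorted (subword w i j)"
    using assms by (auto simp: subword_def sorted_iff_nth_mono)
qed

text \<open>An increasing subword starting at \<open>i\<close> can be extended to the left exactly if
  \<open>i > 0\<close> and there is no descent into \<open>i\<close>; the longest one starting at a run start is therefore a run.\<close>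

lemma ex_is_run_iff: "(\<exists>j. is_run w i j) \<longleftrightarrow> run_start w i"
proof
  assume "\<exists>j. is_run w i j"
  then obtain j where ij: "i \<le> j" "j < length w" and s: "sorted (subword w i j)"
    and mx: "\<And>i' j'. i' \<le> i \<Longrightarrow> j \<le> j' \<Longrightarrow> j' < length w \<Longrightarrow> sorted (subword w i' j')
      \<Longrightarrow> i' = i \<and> j' = j"
    unfolding is_run_def by blast
  show "run_start w i"
  proof (rule ccontr)
    assume "\<not> run_start w i"
    then have i: "i \<noteq> 0" "w ! (i - 1) \<le> w ! i" using ij by (auto simp: run_start_def)
    have "w ! a \<le> w ! b" if "i - 1 \<le> a" "a \<le> b" "b \<le> j" for a b
    proof (cases "i \<le> a")
      case True
      then show ?thesis using s that ij by (auto simp: sorted_subword_iff)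
    next
      case False
      then have a: "a = i - 1" using that by simp
      show ?thesis
      proof (cases "b = a")
        case False
        then have "i \<le> b" using that a i by simp
        then have "w ! i \<le> w ! b" using s that ij by (auto simp: sorted_subword_iff)
        then show ?thesis using i a by simp
      qed simp
    qed
    then have "sorted (subword w (i - 1) j)" using ij by (auto simp: sorted_subword_iff)
    from mx[OF _ _ ij(2) this] show False using i(1) by simp
  qed
next
  assume st: "run_start w i"
  let ?P = "\<lambda>j. i \<le> j \<and> j < length w \<and> sorted (subword w i j)"
  have "w ! a \<le> w ! b" if "i \<le> a" "a \<le> b" "b \<le> i" for a b
  proof -
    have "a = b" using that by linarith
    then show ?thesis by simp
  qed
  then have "?P i" using st by (auto simp: run_start_def sorted_subword_iff)
  moreover have "\<forall>j. ?P j \<longrightarrow> j \<le> length w" by simp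
  ultimately obtain j where j: "?P j" and mx: "\<And>j'. ?P j' \<Longrightarrow> j' \<le> j"
    using Greatest_le_nat[of ?P _ "length w"] GreatestI_nat[of ?P i "length w"] by blast
  have "i' = i \<and> j' = j"
    if "i' \<le> i" "j \<le> j'" "j' < length w" "sorted (subword w i' j')" for i' j'
  proof -
    have i': "i' = i"
    proof (rule ccontr)
      assume "i' \<noteq> i"
      then have "w ! (i - 1) \<le> w ! i"
        using that j by (auto simp: sorted_subword_iff)
      then show False using st \<open>i' \<noteq> i\<close> that by (auto simp: run_start_def)
    qed
    then show ?thesis using mx[of j'] that j by auto
  qed
  then show "\<exists>j. is_run w i j" using j unfolding is_run_def by blast
qed

lemma sorted_nths_iff:
  "sorted (nths w I) \<longleftrightarrow>
    (\<forall>i j. i \<in> I \<and> j \<in> I \<and> i \<le> j \<and> j < length w \<longrightarrow> w ! i \<le> w ! j)"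
proof (induction w rule: rev_induct)
  case (snoc x w)
  have "sorted (nths (w @ [x]) I) \<longleftrightarrow>
    sorted (nths w I) \<and> (length w \<in> I \<longrightarrow> (\<forall>i\<in>I. i < length w \<longrightarrow> w ! i \<le> x))"
    by (auto simp: nths_append sorted_append set_nths nths_singleton)
  also have "\<dots> \<longleftrightarrow> (\<forall>i j. i \<in> I \<and> j \<in> I \<and> i \<le> j \<and> j < length (w @ [x]) \<longrightarrow>
      (w @ [x]) ! i \<le> (w @ [x]) ! j)"
    unfolding snoc.IH by (auto simp: nth_append less_Suc_eq)
  finally show ?case .
qed simp

text \<open>If the leaders increase, then a leader is at most any later letter \<open>w ! q\<close>, because the
  leader of the run containing \<open>q\<close> lies in between.\<close>

lemma flattened_iff: "flattened w \<longleftrightarrow> (\<forall>p. run_start w p \<longrightarrow> rl_min w p)"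
proof
  assume f: "flattened w"
  have le: "w ! i \<le> w ! j" if "run_start w i" "run_start w j" "i \<le> j" for i j
    using f that unfolding flattened_def run_leaders_def ex_is_run_iff sorted_nths_iff
    by (auto simp: run_start_def)
  have "w ! p \<le> w ! q" if p: "run_start w p" and pq: "p \<le> q" "q < length w" for p q
  proof -
    \<comment> \<open>Going right from \<open>p\<close>, the current leader \<open>i\<close> is replaced at each descent.\<close>
    have "\<exists>i. p \<le> i \<and> i \<le> q \<and> run_start w i \<and> w ! i \<le> w ! q"
      using pq
    proof (induction q rule: dec_induct)
      case base
      then show ?case using p by auto
    next
      case (step q)
      show ?case
      proof (cases "w ! Suc q < w ! q")
        case True
        then have "run_start w (Suc q)" using step by (simp add: run_start_def)
        then show ?thesis using step by (intro exI[of _ "Suc q"]) auto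
      next
        case False
        obtain i where "p \<le> i" "i \<le> q" "run_start w i" "w ! i \<le> w ! q"
          using step by auto
        then show ?thesis using False by (intro exI[of _ i]) auto
      qed
    qed
    then show ?thesis using le p by (meson order.trans)
  qed
  then show "\<forall>p. run_start w p \<longrightarrow> rl_min w p" by (auto simp: rl_min_def)
next
  assume "\<forall>p. run_start w p \<longrightarrow> rl_min w p"
  then show "flattened w"
    unfolding flattened_def run_leaders_def ex_is_run_iff sorted_nths_iff
    by (auto simp: rl_min_def)
qed

section \<open>Inserting the two copies of the largest letter\<close>

definition insert_twice :: "'a \<Rightarrow> 'a list \<Rightarrow> nat \<Rightarrow> 'a list" where
  "insert_twice m w p = take p w @ [m, m] @ drop p w"

text \<open>The position in \<open>insert_twice m w p\<close> of the letter that was at position \<open>i\<close> of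
  \<open>w\<close>; the two copies of \<open>m\<close> take the remaining positions \<open>p\<close> and
  \<open>Suc p\<close>.\<close>

definition shift :: "nat \<Rightarrow> nat \<Rightarrow> nat" where
  "shift p i = (if i < p then i else i + 2)"

text \<open>In a flattened word the first position is always a right-to-left minimum. Leaving it out makes
  these positions exactly the gaps before the end where inserting the new largest letter
  keeps the word flattened.\<close>

definition inner_rl_mins :: "'a::linorder list \<Rightarrow> nat set" where
  "inner_rl_mins w = {p. 1 \<le> p \<and> p < length w \<and> rl_min w p}"

lemma shift_cases: obtains i where "q = shift p i" | "q = p" | "q = Suc p"
proof -
  have "q < p \<or> q = p \<or> q = Suc p \<or> p + 2 \<le> q" by linarith
  moreover have "q = shift p q" if "q < p" using that by (simp add: shift_def)
  moreover have "q = shift p (q - 2)" if "p + 2 \<le> q" using that by (auto simp: shift_def)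
  ultimately show thesis using that by blast
qed

lemma shift_less_iff [simp]: "shift p i < shift p j \<longleftrightarrow> i < j"
  and shift_le_iff [simp]: "shift p i \<le> shift p j \<longleftrightarrow> i \<le> j"
  and shift_inject [simp]: "shift p i = shift p j \<longleftrightarrow> i = j"
  by (auto simp: shift_def)

lemma shift_neq [simp]: "shift p i \<noteq> p" "shift p i \<noteq> Suc p"
  by (auto simp: shift_def)

context
  fixes m :: "'a::linorder" and w :: "'a list" and p :: nat
  assumes p: "p \<le> length w"
begin

lemma length_insert_twice [simp]: "length (insert_twice m w p) = Suc (Suc (length w))"
  using p by (simp add: insert_twice_def)

lemma insert_twice_nth [simp]:
  "insert_twice m w p ! shift p i = w ! i"
  "insert_twice m w p ! p = m"
  "insert_twice m w p ! Suc p = m"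
  using p by (auto simp: insert_twice_def shift_def nth_append)

lemma shift_less_length [simp]: "shift p i < Suc (Suc (length w)) \<longleftrightarrow> i < length w"
  using p by (auto simp: shift_def)

lemma set_insert_twice: "set (insert_twice m w p) = insert m (set w)"
proof -
  have "set w = set (take p w) \<union> set (drop p w)" by (metis append_take_drop_id set_append)
  then show ?thesis by (auto simp: insert_twice_def)
qed

lemma count_list_insert_twice:
  "count_list (insert_twice m w p) i = count_list w i + (if i = m then 2 else 0)"
proof -
  have "count_list w i = count_list (take p w) i + count_list (drop p w) i"
    by (metis append_take_drop_id count_list_append)
  then show ?thesis by (auto simp: insert_twice_def)
qed

end

context
  fixes m :: "'a::linorder" and w :: "'a list" and p :: nat
  assumes p [simp]: "p \<le> length w" and m: "\<forall>x\<in>set w. x < m"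
begin

lemma rl_min_insert_twice:
  assumes "i < length w"
  shows "rl_min (insert_twice m w p) (shift p i) \<longleftrightarrow> rl_min w i"
proof
  assume r: "rl_min (insert_twice m w p) (shift p i)"
  show "rl_min w i" unfolding rl_min_def
  proof (intro allI impI)
    fix q assume "i \<le> q \<and> q < length w"
    then show "w ! i \<le> w ! q"
      using r[unfolded rl_min_def, rule_format, of "shift p q"] by simp
  qed
next
  assume r: "rl_min w i"
  show "rl_min (insert_twice m w p) (shift p i)" unfolding rl_min_def
  proof (intro allI impI)
    fix q assume q: "shift p i \<le> q \<and> q < length (insert_twice m w p)"
    have "w ! i < m" using m assms by simp
    then show "insert_twice m w p ! shift p i \<le> insert_twice m w p ! q"
      using q r by (cases q p rule: shift_cases) (auto simp: rl_min_def)
  qed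
qed

lemma rl_min_new_letters:
  "rl_min (insert_twice m w p) p \<longleftrightarrow> p = length w"
  "rl_min (insert_twice m w p) (Suc p) \<longleftrightarrow> p = length w"
proof -
  have hyp: "\<not> rl_min (insert_twice m w p) q" if "q = p \<or> q = Suc p" "p < length w" for q
  proof
    assume "rl_min (insert_twice m w p) q"
    then have "insert_twice m w p ! q \<le> insert_twice m w p ! shift p p"
      using that unfolding rl_min_def by (auto simp: shift_def)
    moreover have "w ! p < m" using m that by simp
    ultimately show False using that by auto
  qed
  have "rl_min (insert_twice m w p) q" if "q = p \<or> q = Suc p" "p = length w" for q
    unfolding rl_min_def
  proof (intro allI impI)
    fix q' assume "q \<le> q' \<and> q' < length (insert_twice m w p)"
    then have "q' = p \<or> q' = Suc p" using that p by auto
    then show "insert_twice m w p ! q \<le> insert_twice m w p ! q'" using that(1) by auto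
  qed
  then show "rl_min (insert_twice m w p) p \<longleftrightarrow> p = length w"
    "rl_min (insert_twice m w p) (Suc p) \<longleftrightarrow> p = length w"
    using hyp p by (auto simp: le_less)
qed

lemma inner_rl_mins_insert_twice:
  assumes "1 \<le> p"
  shows "inner_rl_mins (insert_twice m w p) =
    shift p ` inner_rl_mins w \<union> (if p = length w then {p, Suc p} else {})"
proof -
  have "q \<in> inner_rl_mins (insert_twice m w p) \<longleftrightarrow>
    q \<in> shift p ` inner_rl_mins w \<union> (if p = length w then {p, Suc p} else {})" for q
  proof (cases q p rule: shift_cases)
    case (1 i)
    have "Suc 0 \<le> shift p i \<longleftrightarrow> Suc 0 \<le> i" using assms by (auto simp: shift_def)
    moreover have "i < length w \<and> rl_min (insert_twice m w p) q \<longleftrightarrow> i < length w \<and> rl_min w i"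
      using 1 rl_min_insert_twice by blast
    ultimately show ?thesis
      using 1 by (auto simp: inner_rl_mins_def)
  qed (use assms in \<open>auto simp: inner_rl_mins_def rl_min_new_letters image_iff dest: sym\<close>)
  then show ?thesis by blast
qed

text \<open>A descent into a position \<open>i \<noteq> p\<close> is not affected by the insertion. The copies of
  \<open>m\<close> start no run unless they come first, but the letter after them, if any, always does. Hence the
  condition for the new word is the old one together with the requirement that position \<open>p\<close>,
  if it exists in \<open>w\<close>, be a right-to-left minimum.\<close>

lemma flattened_insert_twice_iff:
  assumes "w \<noteq> []"
  shows "flattened (insert_twice m w p) \<longleftrightarrow>
    flattened w \<and> p \<in> insert (length w) (inner_rl_mins w)"
proof (cases "p = 0")
  case True
  then have "run_start (insert_twice m w p) 0" using length_insert_twice[OF p, of m]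
    by (simp add: run_start_def del: length_insert_twice)
  then have "\<not> flattened (insert_twice m w p)"
    using rl_min_new_letters True assms by (auto simp: flattened_iff)
  then show ?thesis using True assms by (auto simp: inner_rl_mins_def)
next
  case False
  let ?v = "insert_twice m w p"
  have new: "\<not> run_start ?v p" "\<not> run_start ?v (Suc p)"
  proof -
    have "?v ! (p - 1) = w ! (p - 1)"
      using insert_twice_nth(1)[OF p, of m "p - 1"] False
      by (simp add: shift_def del: insert_twice_nth)
    moreover have "w ! (p - 1) \<in> set w" by (rule nth_mem) (use False p in linarith)
    then have "w ! (p - 1) < m" using m by blast
    ultimately show "\<not> run_start ?v p" using False by (auto simp: run_start_def)
    show "\<not> run_start ?v (Suc p)" by (simp add: run_start_def)
  qed
  \<comment> \<open>The letter at \<open>i = p\<close> now follows the larger letter \<open>m\<close>.\<close>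
  have old: "run_start ?v (shift p i) \<longleftrightarrow> run_start w i \<or> i = p" if "i < length w" for i
  proof -
    consider "i = 0" | "i = p" | "i \<noteq> 0" "i \<noteq> p" by blast
    then show ?thesis
    proof cases
      case 2
      then have "shift p i - 1 = Suc p" by (simp add: shift_def)
      moreover have "w ! i < m" using m that by simp
      ultimately show ?thesis using 2 that by (simp add: run_start_def)
    next
      case 3
      then have "shift p i - 1 = shift p (i - 1)" "shift p i \<noteq> 0" by (auto simp: shift_def)
      then show ?thesis using 3 that by (simp add: run_start_def)
    qed (use False that in \<open>simp_all add: run_start_def shift_def\<close>)
  qed
  have "flattened ?v \<longleftrightarrow> (\<forall>i<length w. run_start ?v (shift p i) \<longrightarrow> rl_min ?v (shift p i))"
    (is "_ \<longleftrightarrow> ?R")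
  proof
    assume R: ?R
    show "flattened ?v" unfolding flattened_iff
    proof (intro allI impI)
      fix q assume q: "run_start ?v q"
      show "rl_min ?v q"
      proof (cases q p rule: shift_cases)
        case (1 i)
        moreover have "i < length w" using q 1 by (simp add: run_start_def)
        ultimately show ?thesis using R q by simp
      qed (use q new in auto)
    qed
  qed (simp add: flattened_iff)
  also have "\<dots> \<longleftrightarrow> (\<forall>i<length w. run_start w i \<or> i = p \<longrightarrow> rl_min w i)"
    using old rl_min_insert_twice by auto
  also have "\<dots> \<longleftrightarrow> flattened w \<and> (p = length w \<or> rl_min w p)"
    using p by (auto simp: flattened_iff run_start_def le_less simp del: p)
  finally show ?thesis using False p by (auto simp: inner_rl_mins_def le_less simp del: p)
qed

end

lemma card_inner_rl_mins_insert_twice: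
  assumes "\<forall>x\<in>set w. x < m" "1 \<le> p" "p \<le> length w"
  shows "card (inner_rl_mins (insert_twice m w p)) =
    card (inner_rl_mins w) + (if p = length w then 2 else 0)"
proof -
  have fin: "finite (inner_rl_mins w)"
    by (rule finite_subset[of _ "{..<length w}"]) (auto simp: inner_rl_mins_def)
  have "card (shift p ` inner_rl_mins w) = card (inner_rl_mins w)"
    by (rule card_image) (simp add: inj_on_def)
  moreover have "card (shift p ` inner_rl_mins w \<union> {p, Suc p}) =
      card (shift p ` inner_rl_mins w) + card {p, Suc p}"
    by (rule card_Un_disjoint) (use fin in \<open>auto simp: shift_neq[symmetric]\<close>)
  ultimately show ?thesis
    unfolding inner_rl_mins_insert_twice[OF assms(3,1,2)]
    by (cases "p = length w") (simp_all del: Un_insert_right)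
qed

text \<open>Deleting \<open>m\<close> recovers the word, and the number of letters before the first \<open>m\<close>
  recovers the gap.\<close>

lemma insert_twice_inject:
  assumes "m \<notin> set w" "m \<notin> set v" "p \<le> length w" "q \<le> length v"
    and eq: "insert_twice m w p = insert_twice m v q"
  shows "w = v \<and> p = q"
proof
  have rem: "removeAll m (insert_twice m u r) = u" if "m \<notin> set u" for u r
  proof -
    have "m \<notin> set (take r u)" "m \<notin> set (drop r u)"
      using that by (meson in_set_takeD in_set_dropD)+
    then show ?thesis by (simp add: insert_twice_def)
  qed
  show "w = v" using rem[of w p] rem[of v q] assms by simp
  have idx: "length (takeWhile (\<lambda>x. x \<noteq> m) (insert_twice m u r)) = r"
    if "m \<notin> set u" "r \<le> length u" for u r
  proof -
    have "\<forall>x\<in>set (take r u). x \<noteq> m" using that by (auto dest: in_set_takeD)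
    then show ?thesis using that by (simp add: insert_twice_def takeWhile_append2)
  qed
  show "p = q" using idx[of w p] idx[of v q] assms by simp
qed

text \<open>The condition on repeated letters is inherited in both directions: two equal letters of the new
  word are either the two adjacent copies of the new letter, with nothing between them, or two old
  letters, which are smaller than the new one.\<close>

lemma stirling_insert_twice_iff:
  assumes m: "\<forall>x\<in>set w. x < Suc N" and p: "p \<le> length w"
  shows "insert_twice (Suc N) w p \<in> stirling_perms (Suc N) \<longleftrightarrow> w \<in> stirling_perms N"
proof -
  let ?v = "insert_twice (Suc N) w p"
  let ?S = "\<lambda>w::nat list. \<forall>a k b. a < k \<and> k < b \<and> b < length w \<and> w ! a = w ! b \<longrightarrow> w ! a < w ! k"
  have notin: "Suc N \<notin> set w" using m by blast
  have "set ?v \<subseteq> {1..Suc N} \<longleftrightarrow> set w \<subseteq> {1..N}"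
    using m by (fastforce simp: set_insert_twice[OF p])
  moreover have "(\<forall>i\<in>{1..Suc N}. count_list ?v i = 2) \<longleftrightarrow> (\<forall>i\<in>{1..N}. count_list w i = 2)"
  proof -
    have "count_list w (Suc N) = 0" using notin by (simp add: count_list_0_iff)
    then show ?thesis by (auto simp: count_list_insert_twice[OF p] atLeastAtMostSuc_conv)
  qed
  moreover have "?S ?v \<longleftrightarrow> ?S w"
  proof
    assume S: "?S ?v"
    show "?S w"
    proof (intro allI impI)
      fix a k b assume "a < k \<and> k < b \<and> b < length w \<and> w ! a = w ! b"
      then show "w ! a < w ! k"
        using S[rule_format, of "shift p a" "shift p k" "shift p b"] p by simp
    qed
  next
    assume S: "?S w"
    show "?S ?v"
    proof (intro allI impI)
      fix a k b assume h: "a < k \<and> k < b \<and> b < length ?v \<and> ?v ! a = ?v ! b"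
      have small: "w ! i < Suc N" if "i < length w" for i using m that by simp
      have oldpos: "i < length w" if "shift p i < Suc (Suc (length w))" for i
        using that p by simp
      \<comment> \<open>A later letter equal to the new one can only be its second copy.\<close>
      have False if "a = p \<or> a = Suc p"
      proof (cases b p rule: shift_cases)
        case (1 i)
        then show False using that h p small[of i] by auto
      qed (use that h in auto)
      then obtain i where i: "a = shift p i" by (cases a p rule: shift_cases) auto
      have il: "i < length w" using oldpos[of i] h unfolding i length_insert_twice[OF p] by linarith
      obtain j where j: "b = shift p j"
        using h i p small[OF il] by (cases b p rule: shift_cases) auto
      show "?v ! a < ?v ! k"
      proof (cases k p rule: shift_cases)
        case (1 l)
        then show ?thesis using h i j p S[rule_format, of i l j] by auto
      qed (use i p small[OF il] in auto)
    qed
  qed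
  ultimately show ?thesis by (simp add: stirling_perms_def)
qed

text \<open>A letter between the two copies of the largest letter would have to exceed it, so the copies are
  adjacent.\<close>

lemma stirling_perms_Suc_cases:
  assumes "v \<in> stirling_perms (Suc N)"
  obtains w p where "v = insert_twice (Suc N) w p" "p \<le> length w" "\<forall>x\<in>set w. x < Suc N"
proof -
  let ?m = "Suc N"
  have sub: "set v \<subseteq> {1..?m}" and cnt: "count_list v ?m = 2"
    and S: "\<And>a k b. a < k \<Longrightarrow> k < b \<Longrightarrow> b < length v \<Longrightarrow> v ! a = v ! b \<Longrightarrow> v ! a < v ! k"
    using assms by (auto simp: stirling_perms_def)
  have "?m \<in> set v" using cnt count_list_0_iff[of v ?m] by auto
  then obtain xs ys where v: "v = xs @ ?m # ys" "?m \<notin> set xs" by (meson split_list_first)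
  then have c1: "count_list ys ?m = 1" using cnt by (auto simp: count_list_0_iff)
  then have "?m \<in> set ys" using count_list_0_iff[of ys ?m] by auto
  then obtain zs us where ys: "ys = zs @ ?m # us" "?m \<notin> set zs" by (meson split_list_first)
  then have "count_list us ?m = 0" using c1 by (auto simp: count_list_0_iff)
  then have us: "?m \<notin> set us" using count_list_0_iff[of us ?m] by auto
  have "zs = []"
  proof (rule ccontr)
    assume ne: "zs \<noteq> []"
    have "v ! length xs = ?m" "v ! (length xs + Suc (length zs)) = ?m"
      by (simp_all add: v ys nth_append)
    moreover have "v ! Suc (length xs) \<in> set v" by (rule nth_mem) (simp add: v ys)
    then have "v ! Suc (length xs) \<le> ?m" using sub by auto
    ultimately show False
      using S[of "length xs" "Suc (length xs)" "length xs + Suc (length zs)"] ne v ys by auto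
  qed
  then have "v = insert_twice ?m (xs @ us) (length xs)"
    by (simp add: insert_twice_def v ys)
  moreover have "\<forall>x\<in>set (xs @ us). x < ?m"
  proof
    fix x assume "x \<in> set (xs @ us)"
    moreover from this have "x \<noteq> ?m" using v(2) us by auto
    moreover have "set (xs @ us) \<subseteq> set v" by (auto simp: v ys)
    then have "x \<le> ?m" using sub \<open>x \<in> set (xs @ us)\<close> by fastforce
    ultimately show "x < ?m" by simp
  qed
  ultimately show thesis using that[of "xs @ us" "length xs"] by simp
qed

lemma stirling_permsD:
  assumes "w \<in> stirling_perms N" "1 \<le> N"
  shows "w \<noteq> []" "\<forall>x\<in>set w. x < Suc N"
  using assms by (auto simp: stirling_perms_def)

lemma bij_betw_insert_twice:
  assumes N: "1 \<le> N"
  shows "bij_betw (\<lambda>(w, p). insert_twice (Suc N) w p)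
    (SIGMA w:flat (stirling_perms N). insert (length w) (inner_rl_mins w))
    (flat (stirling_perms (Suc N)))"
  unfolding bij_betw_def
proof
  let ?D = "SIGMA w:flat (stirling_perms N). insert (length w) (inner_rl_mins w)"
  have le: "p \<le> length w" if "p \<in> insert (length w) (inner_rl_mins w)"
    for p and w :: "nat list"
    using that by (auto simp: inner_rl_mins_def)
  have st: "w \<in> stirling_perms N" if "w \<in> flat (stirling_perms N)" for w
    using that by (simp add: flat_def)
  show "inj_on (\<lambda>(w, p). insert_twice (Suc N) w p) ?D"
  proof (rule inj_onI, clarify)
    fix w p v q
    assume "w \<in> flat (stirling_perms N)" "v \<in> flat (stirling_perms N)"
      and "p \<in> insert (length w) (inner_rl_mins w)" "q \<in> insert (length v) (inner_rl_mins v)"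
      and eq: "insert_twice (Suc N) w p = insert_twice (Suc N) v q"
    moreover from this have "Suc N \<notin> set w" "Suc N \<notin> set v"
      using stirling_permsD(2)[OF st N] by blast+
    ultimately show "w = v \<and> p = q" using le by (intro insert_twice_inject) auto
  qed
  show "(\<lambda>(w, p). insert_twice (Suc N) w p) ` ?D = flat (stirling_perms (Suc N))"
  proof (intro equalityI subsetI)
    fix v assume "v \<in> (\<lambda>(w, p). insert_twice (Suc N) w p) ` ?D"
    then obtain w p where w: "w \<in> stirling_perms N" "flattened w"
      and p: "p \<in> insert (length w) (inner_rl_mins w)" and v: "v = insert_twice (Suc N) w p"
      by (auto simp: flat_def)
    then show "v \<in> flat (stirling_perms (Suc N))"
      using stirling_permsD[OF w(1) N] le[OF p]
      by (simp add: flat_def stirling_insert_twice_iff flattened_insert_twice_iff)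
  next
    fix v assume v: "v \<in> flat (stirling_perms (Suc N))"
    then obtain w p where wp: "v = insert_twice (Suc N) w p" "p \<le> length w"
      and m: "\<forall>x\<in>set w. x < Suc N"
      by (auto simp: flat_def elim: stirling_perms_Suc_cases)
    have w: "w \<in> stirling_perms N"
      using v wp m by (simp add: flat_def stirling_insert_twice_iff)
    then have "flattened w \<and> p \<in> insert (length w) (inner_rl_mins w)"
      using v wp m stirling_permsD(1)[OF w N]
      by (simp add: flat_def flattened_insert_twice_iff)
    then show "v \<in> (\<lambda>(w, p). insert_twice (Suc N) w p) ` ?D"
      using w wp by (force simp: flat_def)
  qed
qed

text \<open>The word \<open>1 1\<close> arises from the empty word, the only Stirling permutation of order 0. The
  generating process itself starts at order 1, since into the empty word the only insertion is at a
  gap that is both the front and the end.\<close>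

lemma flat_stirling_perms_1: "flat (stirling_perms 1) = {[1, 1]}"
proof -
  have "insert_twice 1 [] 0 = [1, 1 :: nat]" by (simp add: insert_twice_def)
  moreover have "[] \<in> stirling_perms 0" by (simp add: stirling_perms_def)
  ultimately have "[1, 1] \<in> stirling_perms 1"
    using stirling_insert_twice_iff[of "[]" 0 0] by simp
  moreover have "flattened [1, 1 :: nat]"
    by (auto simp: flattened_iff rl_min_def run_start_def less_Suc_eq le_Suc_eq nth_Cons')
  moreover have "v = [1, 1]" if v: "v \<in> stirling_perms 1" for v
  proof -
    obtain w p where w: "v = insert_twice 1 w p" "p \<le> length w" "\<forall>x\<in>set w. x < 1"
      using v stirling_perms_Suc_cases[of v 0] by auto
    then have "w \<in> stirling_perms 0" using v stirling_insert_twice_iff[of w 0 p] by simp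
    then show ?thesis using w by (simp add: stirling_perms_def insert_twice_def)
  qed
  then have "stirling_perms 1 \<subseteq> {[1, 1]}" by (intro subsetI singletonI) simp
  ultimately show ?thesis unfolding flat_def by blast
qed

section \<open>Type B partitions\<close>

lemma mem_neg_iff [simp]: "x \<in> uminus ` \<beta> \<longleftrightarrow> - x \<in> \<beta>" for x :: int
  by force

lemma neg_eq_iff: "uminus ` \<beta> = \<gamma> \<longleftrightarrow> \<beta> = uminus ` \<gamma>" for \<beta> \<gamma> :: "int set"
  by (auto simp: image_image)

text \<open>The block of 0 and its negative both contain 0, so this block is always equal to its negative.
  Uniqueness of the zero-block therefore says that no block without 0 is equal to its negative, a
  condition that can be checked block by block.\<close>

lemma typeB_partitions_iff:
  "\<B> \<in> typeB_partitions n \<longleftrightarrow> partition_on {- int n..int n} \<B> \<and>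
    (\<forall>\<beta>\<in>\<B>. uminus ` \<beta> \<in> \<B>) \<and> (\<forall>\<beta>\<in>\<B>. uminus ` \<beta> = \<beta> \<longrightarrow> 0 \<in> \<beta>)"
proof -
  have zero_block: "(\<exists>!\<beta>. \<beta> \<in> \<B> \<and> uminus ` \<beta> = \<beta>) \<longleftrightarrow>
      (\<forall>\<beta>\<in>\<B>. uminus ` \<beta> = \<beta> \<longrightarrow> 0 \<in> \<beta>)"
    if P: "partition_on {- int n..int n} \<B>" and neg: "\<forall>\<beta>\<in>\<B>. uminus ` \<beta> \<in> \<B>"
  proof -
    have "0 \<in> \<Union>\<B>" using partition_onD1[OF P] by auto
    then obtain Z where Z: "Z \<in> \<B>" "0 \<in> Z" by blast
    have zero: "\<gamma> = Z" if "\<gamma> \<in> \<B>" "0 \<in> \<gamma>" for \<gamma>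
      using partition_onD2[OF P] that Z by (auto simp: disjoint_def)
    have "uminus ` Z = Z" by (rule zero) (use Z neg in auto)
    then have "(\<exists>!\<beta>. \<beta> \<in> \<B> \<and> uminus ` \<beta> = \<beta>) \<longleftrightarrow>
        (\<forall>\<beta>\<in>\<B>. uminus ` \<beta> = \<beta> \<longrightarrow> \<beta> = Z)"
      using Z(1) by metis
    then show ?thesis using Z zero by metis
  qed
  show ?thesis unfolding typeB_partitions_def mem_Collect_eq
    by (intro conj_cong refl) (rule zero_block)
qed

lemma typeB_partitionsD:
  assumes "\<B> \<in> typeB_partitions n"
  shows "\<beta> \<in> \<B> \<Longrightarrow> uminus ` \<beta> \<in> \<B>"
    and "\<beta> \<in> \<B> \<Longrightarrow> uminus ` \<beta> = \<beta> \<Longrightarrow> 0 \<in> \<beta>"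
    and "\<Union>\<B> = {- int n..int n}"
    and "\<beta> \<in> \<B> \<Longrightarrow> \<beta> \<noteq> {}"
    and "\<beta> \<in> \<B> \<Longrightarrow> \<gamma> \<in> \<B> \<Longrightarrow> x \<in> \<beta> \<Longrightarrow> x \<in> \<gamma> \<Longrightarrow> \<beta> = \<gamma>"
  using assms by (auto simp: typeB_partitions_iff partition_on_def disjoint_def)

lemma typeB_partitionsI:
  assumes "\<And>\<beta>. \<beta> \<in> \<B> \<Longrightarrow> uminus ` \<beta> \<in> \<B>"
    and "\<And>\<beta>. \<beta> \<in> \<B> \<Longrightarrow> uminus ` \<beta> = \<beta> \<Longrightarrow> 0 \<in> \<beta>"
    and "\<Union>\<B> = {- int n..int n}"
    and "{} \<notin> \<B>"
    and "\<And>\<beta> \<gamma> x. \<beta> \<in> \<B> \<Longrightarrow> \<gamma> \<in> \<B> \<Longrightarrow> x \<in> \<beta> \<Longrightarrow> x \<in> \<gamma> \<Longrightarrow> \<beta> = \<gamma>"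
  shows "\<B> \<in> typeB_partitions n"
proof -
  have "disjoint \<B>" using assms(5) unfolding disjoint_def by blast
  then show ?thesis using assms by (simp add: typeB_partitions_iff partition_on_def)
qed

lemma finite_typeB_partitions: "finite (typeB_partitions n)"
  by (rule finite_subset[of _ "Pow (Pow {- int n..int n})"])
    (auto simp: typeB_partitions_def partition_on_def)

text \<open>The block \<open>\<gamma>\<close> after \<open>m\<close> has been put into the block \<open>\<beta>\<close> and
  \<open>-m\<close> into the negative of \<open>\<beta>\<close>. The two conditions may hold together: the
  zero-block receives both numbers.\<close>

definition extend_block :: "int \<Rightarrow> int set \<Rightarrow> int set \<Rightarrow> int set" where
  "extend_block m \<beta> \<gamma> = \<gamma> \<union> {x. x = m \<and> \<gamma> = \<beta> \<or> x = - m \<and> \<gamma> = uminus ` \<beta>}"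

text \<open>The empty set, never a block, serves as the label for making two new singleton blocks.\<close>

definition insert_pair :: "int \<Rightarrow> int set set \<Rightarrow> int set \<Rightarrow> int set set" where
  "insert_pair m \<B> \<beta> = (if \<beta> = {} then {{m}, {- m}} \<union> \<B> else extend_block m \<beta> ` \<B>)"

context
  fixes n :: nat and \<B> :: "int set set" and m :: int
  assumes B: "\<B> \<in> typeB_partitions n" and m: "m = int n + 1"
begin

lemma new_notin_block:
  assumes "\<gamma> \<in> \<B>"
  shows "m \<notin> \<gamma>" "- m \<notin> \<gamma>"
proof -
  have "\<gamma> \<subseteq> {- int n..int n}" using typeB_partitionsD(3)[OF B] assms by blast
  then show "m \<notin> \<gamma>" "- m \<notin> \<gamma>" using m by auto
qed

lemma extend_block_minus: "\<gamma> \<in> \<B> \<Longrightarrow> extend_block m \<beta> \<gamma> - {m, - m} = \<gamma>"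
  using new_notin_block by (auto simp: extend_block_def)

lemma mem_extend_block_iff:
  assumes "\<gamma> \<in> \<B>"
  shows "x \<in> extend_block m \<beta> \<gamma> \<longleftrightarrow>
    (if x = m then \<gamma> = \<beta> else if x = - m then \<gamma> = uminus ` \<beta> else x \<in> \<gamma>)"
  using new_notin_block[OF assms] m by (auto simp: extend_block_def)

text \<open>The rule for placing the two new numbers is symmetric under negation, so the enlarged
  partition is still closed under negation.\<close>

lemma neg_extend_block:
  assumes "\<gamma> \<in> \<B>"
  shows "uminus ` extend_block m \<beta> \<gamma> = extend_block m \<beta> (uminus ` \<gamma>)"
proof (rule set_eqI)
  fix x
  show "x \<in> uminus ` extend_block m \<beta> \<gamma> \<longleftrightarrow> x \<in> extend_block m \<beta> (uminus ` \<gamma>)"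
    using m unfolding mem_neg_iff mem_extend_block_iff[OF assms]
      mem_extend_block_iff[OF typeB_partitionsD(1)[OF B assms]]
    by (auto simp: neg_eq_iff image_image)
qed

lemma inj_on_extend_block: "inj_on (extend_block m \<beta>) \<B>"
  by (rule inj_on_inverseI[where g = "\<lambda>\<gamma>. \<gamma> - {m, - m}"]) (rule extend_block_minus)

lemma interval_Suc: "{- int (Suc n)..int (Suc n)} = {m, - m} \<union> {- int n..int n}"
  using m by auto

lemma insert_pair_empty_typeB: "insert_pair m \<B> {} \<in> typeB_partitions (Suc n)"
proof (rule typeB_partitionsI)
  show "\<Union>(insert_pair m \<B> {}) = {- int (Suc n)..int (Suc n)}"
    unfolding interval_Suc using typeB_partitionsD(3)[OF B] by (auto simp: insert_pair_def)
  show "{} \<notin> insert_pair m \<B> {}"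
    using typeB_partitionsD(4)[OF B] by (auto simp: insert_pair_def)
  show "uminus ` \<gamma> \<in> insert_pair m \<B> {}" if "\<gamma> \<in> insert_pair m \<B> {}" for \<gamma>
    using that typeB_partitionsD(1)[OF B] by (auto simp: insert_pair_def)
  show "0 \<in> \<gamma>" if "\<gamma> \<in> insert_pair m \<B> {}" "uminus ` \<gamma> = \<gamma>" for \<gamma>
    using that typeB_partitionsD(2)[OF B] m by (auto simp: insert_pair_def)
  show "\<gamma> = \<delta>" if "\<gamma> \<in> insert_pair m \<B> {}" "\<delta> \<in> insert_pair m \<B> {}" "x \<in> \<gamma>" "x \<in> \<delta>"
    for \<gamma> \<delta> x
    using that typeB_partitionsD(5)[OF B, of \<gamma> \<delta> x] m new_notin_block
    by (auto simp: insert_pair_def)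
qed

lemma insert_pair_block_typeB:
  assumes \<beta>: "\<beta> \<in> \<B>"
  shows "insert_pair m \<B> \<beta> \<in> typeB_partitions (Suc n)"
proof -
  have ne: "\<beta> \<noteq> {}" using \<beta> typeB_partitionsD(4)[OF B] by blast
  have neg: "\<gamma> \<in> \<B> \<Longrightarrow> uminus ` \<gamma> \<in> \<B>" for \<gamma> by (rule typeB_partitionsD(1)[OF B])
  have "extend_block m \<beta> ` \<B> \<in> typeB_partitions (Suc n)"
  proof (rule typeB_partitionsI)
    have "x \<in> \<Union>(extend_block m \<beta> ` \<B>) \<longleftrightarrow> x \<in> {m, - m} \<union> \<Union>\<B>" for x
    proof -
      have "x \<in> \<Union>(extend_block m \<beta> ` \<B>) \<longleftrightarrow> (\<exists>\<gamma>\<in>\<B>. x \<in> extend_block m \<beta> \<gamma>)" by blast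
      also have "\<dots> \<longleftrightarrow> (\<exists>\<gamma>\<in>\<B>. if x = m then \<gamma> = \<beta>
          else if x = - m then \<gamma> = uminus ` \<beta> else x \<in> \<gamma>)"
        by (rule bex_cong[OF refl]) (rule mem_extend_block_iff)
      also have "\<dots> \<longleftrightarrow> x \<in> {m, - m} \<union> \<Union>\<B>" using \<beta> neg[OF \<beta>] m by auto
      finally show ?thesis .
    qed
    then show "\<Union>(extend_block m \<beta> ` \<B>) = {- int (Suc n)..int (Suc n)}"
      unfolding interval_Suc using typeB_partitionsD(3)[OF B] by blast
    show "{} \<notin> extend_block m \<beta> ` \<B>"
      using typeB_partitionsD(4)[OF B] by (auto simp: extend_block_def)
    show "uminus ` \<gamma> \<in> extend_block m \<beta> ` \<B>" if "\<gamma> \<in> extend_block m \<beta> ` \<B>" for \<gamma>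
      using that neg by (auto simp: neg_extend_block)
    show "0 \<in> \<gamma>" if \<gamma>: "\<gamma> \<in> extend_block m \<beta> ` \<B>" "uminus ` \<gamma> = \<gamma>" for \<gamma>
    proof -
      obtain \<delta> where \<delta>: "\<delta> \<in> \<B>" "\<gamma> = extend_block m \<beta> \<delta>" using \<gamma> by blast
      then have "extend_block m \<beta> (uminus ` \<delta>) = extend_block m \<beta> \<delta>"
        using \<gamma>(2) by (simp add: neg_extend_block)
      then have "uminus ` \<delta> = \<delta>"
        using inj_onD[OF inj_on_extend_block] neg \<delta>(1) by blast
      then show "0 \<in> \<gamma>" using typeB_partitionsD(2)[OF B \<delta>(1)] \<delta>(2)
        by (simp add: extend_block_def)
    qed
    show "\<gamma> = \<delta>" if "\<gamma> \<in> extend_block m \<beta> ` \<B>" "\<delta> \<in> extend_block m \<beta> ` \<B>" "x \<in> \<gamma>" "x \<in> \<delta>"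
      for \<gamma> \<delta> x
    proof -
      obtain \<gamma>' \<delta>' where "\<gamma>' \<in> \<B>" "\<gamma> = extend_block m \<beta> \<gamma>'" "\<delta>' \<in> \<B>" "\<delta> = extend_block m \<beta> \<delta>'"
        using \<open>\<gamma> \<in> _\<close> \<open>\<delta> \<in> _\<close> by blast
      then show ?thesis
        using \<open>x \<in> \<gamma>\<close> \<open>x \<in> \<delta>\<close> typeB_partitionsD(5)[OF B, of \<gamma>' \<delta>' x]
        by (auto simp: mem_extend_block_iff split: if_splits)
    qed
  qed
  then show ?thesis using ne by (simp add: insert_pair_def)
qed

lemma finite_typeB_partition: "finite \<B>"
  using B finite_elements[of "{- int n..int n}" \<B>] by (simp add: typeB_partitions_iff)

lemma card_insert_pair_block:
  assumes "\<beta> \<in> \<B>"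
  shows "card (insert_pair m \<B> \<beta>) = card \<B>"
  using assms typeB_partitionsD(4)[OF B] inj_on_extend_block
  by (auto simp: insert_pair_def card_image)

lemma card_insert_pair_empty: "card (insert_pair m \<B> {}) = card \<B> + 2"
proof -
  have "{m} \<notin> \<B>" "{- m} \<notin> \<B>" using new_notin_block by blast+
  moreover have "m \<noteq> - m" using m by simp
  ultimately show ?thesis by (simp add: insert_pair_def finite_typeB_partition)
qed

text \<open>Deleting the two new numbers, and the empty blocks that this may leave, recovers the smaller
  partition.\<close>

lemma insert_pair_restrict:
  assumes "\<beta> \<in> insert {} \<B>"
  shows "(\<lambda>\<gamma>. \<gamma> - {m, - m}) ` insert_pair m \<B> \<beta> - {{}} = \<B>"
proof -
  have "(\<lambda>\<gamma>. \<gamma> - {m, - m}) ` \<B> = \<B>"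
    using new_notin_block by (simp add: image_def)
  moreover have "(\<lambda>\<gamma>. \<gamma> - {m, - m}) ` extend_block m \<beta> ` \<B> = \<B>"
    using extend_block_minus by (simp add: image_image)
  moreover have "{} \<notin> \<B>" using typeB_partitionsD(4)[OF B] by blast
  ultimately show ?thesis by (simp add: insert_pair_def)
qed

text \<open>The label is what remains of the block of \<open>m\<close>. The union picks out that block, since only
  one block contains \<open>m\<close>.\<close>

lemma insert_pair_label:
  assumes "\<beta> \<in> insert {} \<B>"
  shows "(\<Union>{\<gamma> \<in> insert_pair m \<B> \<beta>. m \<in> \<gamma>}) - {m, - m} = \<beta>"
proof (cases "\<beta> = {}")
  case True
  have "{\<gamma> \<in> insert_pair m \<B> {}. m \<in> \<gamma>} = {{m}}"
    using m new_notin_block by (auto simp: insert_pair_def)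
  then show ?thesis using True by simp
next
  case False
  then have "{\<gamma> \<in> insert_pair m \<B> \<beta>. m \<in> \<gamma>} = {extend_block m \<beta> \<beta>}"
    using assms by (auto simp: insert_pair_def mem_extend_block_iff)
  then show ?thesis using False assms extend_block_minus by simp
qed

end

text \<open>The label is read off from the block \<open>M\<close> of \<open>m\<close> by deleting the two new numbers. If
  nothing remains, then \<open>-m\<close> is not in \<open>M\<close>, as otherwise \<open>M\<close> would be equal
  to its negative without containing 0; so \<open>m\<close> and \<open>-m\<close> form singleton blocks. If
  something remains, no block becomes empty, so deletion keeps distinct blocks disjoint and
  distinct, and putting the two numbers back is governed by the label.\<close>

lemma insert_pair_surj:
  assumes C: "\<C> \<in> typeB_partitions (Suc n)" and m: "m = int n + 1"
  obtains \<B> \<beta> where "\<B> \<in> typeB_partitions n" "\<beta> \<in> insert {} \<B>" "\<C> = insert_pair m \<B> \<beta>"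
proof -
  have interval: "{- int n..int n} = {- int (Suc n)..int (Suc n)} - {m, - m}"
    using m by auto
  have "m \<in> \<Union>\<C>" using typeB_partitionsD(3)[OF C] m by simp
  then obtain M where M: "M \<in> \<C>" "m \<in> M" by blast
  have neg: "\<gamma> \<in> \<C> \<Longrightarrow> uminus ` \<gamma> \<in> \<C>" for \<gamma> by (rule typeB_partitionsD(1)[OF C])
  note same = typeB_partitionsD(5)[OF C]
  have M': "uminus ` M \<in> \<C>" "- m \<in> uminus ` M" using neg[OF M(1)] M(2) by auto
  have mM: "\<gamma> = M" if "\<gamma> \<in> \<C>" "m \<in> \<gamma>" for \<gamma> using same that M by blast
  have mM': "\<gamma> = uminus ` M" if "\<gamma> \<in> \<C>" "- m \<in> \<gamma>" for \<gamma> using same that M' by blast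
  define \<beta> where "\<beta> = M - {m, - m}"
  show thesis
  proof (cases "\<beta> = {}")
    case True
    have "- m \<notin> M"
    proof
      assume "- m \<in> M"
      then have "uminus ` M = M" using mM' M(1) by simp
      then have "0 \<in> M" using typeB_partitionsD(2)[OF C M(1)] by simp
      then show False using True m by (auto simp: \<beta>_def)
    qed
    then have M_eq: "M = {m}" using True M(2) by (auto simp: \<beta>_def)
    define \<B> where "\<B> = \<C> - {{m}, {- m}}"
    have notin: "m \<notin> \<gamma>" "- m \<notin> \<gamma>" if "\<gamma> \<in> \<B>" for \<gamma>
      using that mM[of \<gamma>] mM'[of \<gamma>] M_eq by (auto simp: \<B>_def)
    have "\<B> \<in> typeB_partitions n"
    proof (rule typeB_partitionsI)
      have "\<Union>\<B> = \<Union>\<C> - {m, - m}" using notin by (auto simp: \<B>_def)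
      then show "\<Union>\<B> = {- int n..int n}"
        using typeB_partitionsD(3)[OF C] interval by simp
      show "uminus ` \<gamma> \<in> \<B>" if "\<gamma> \<in> \<B>" for \<gamma>
        using that neg by (auto simp: \<B>_def neg_eq_iff)
    qed (use typeB_partitionsD[OF C] in \<open>auto simp: \<B>_def\<close>)
    moreover have "\<C> = insert_pair m \<B> {}"
      using M(1) M'(1) M_eq by (auto simp: insert_pair_def \<B>_def)
    ultimately show thesis using that by blast
  next
    case False
    define cut where "cut \<gamma> = \<gamma> - {m, - m}" for \<gamma> :: "int set"
    have cut_neg: "uminus ` cut \<gamma> = cut (uminus ` \<gamma>)" for \<gamma>
      by (auto simp: cut_def)
    have cut_ne: "cut \<gamma> \<noteq> {}" if "\<gamma> \<in> \<C>" for \<gamma>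
    proof
      assume e: "cut \<gamma> = {}"
      then have "\<gamma> = M \<or> \<gamma> = uminus ` M"
        using typeB_partitionsD(4)[OF C that] mM[OF that] mM'[OF that] by (auto simp: cut_def)
      then have "cut \<gamma> = \<beta> \<or> cut \<gamma> = uminus ` \<beta>"
        using cut_neg[of M] by (auto simp: \<beta>_def cut_def)
      then show False using e False by auto
    qed
    have cut_inj: "\<gamma> = \<delta>" if "\<gamma> \<in> \<C>" "\<delta> \<in> \<C>" "x \<in> cut \<gamma>" "x \<in> cut \<delta>" for \<gamma> \<delta> x
      using same[of \<gamma> \<delta> x] that by (auto simp: cut_def)
    have cut_eq: "cut \<gamma> = cut \<delta> \<longleftrightarrow> \<gamma> = \<delta>" if "\<gamma> \<in> \<C>" "\<delta> \<in> \<C>" for \<gamma> \<delta>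
      using cut_inj[OF that] cut_ne[OF that(1)] by blast
    have "cut ` \<C> \<in> typeB_partitions n"
    proof (rule typeB_partitionsI)
      have "\<Union>(cut ` \<C>) = \<Union>\<C> - {m, - m}" by (auto simp: cut_def)
      then show "\<Union>(cut ` \<C>) = {- int n..int n}"
        using typeB_partitionsD(3)[OF C] interval by simp
      show "uminus ` \<gamma> \<in> cut ` \<C>" if "\<gamma> \<in> cut ` \<C>" for \<gamma>
        using that neg cut_neg by auto
      show "{} \<notin> cut ` \<C>" using cut_ne by fastforce
      show "0 \<in> \<gamma>" if \<gamma>: "\<gamma> \<in> cut ` \<C>" "uminus ` \<gamma> = \<gamma>" for \<gamma>
      proof -
        obtain \<delta> where \<delta>: "\<delta> \<in> \<C>" "\<gamma> = cut \<delta>" using \<gamma>(1) by blast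
        then have "uminus ` \<delta> = \<delta>" using \<gamma>(2) cut_neg cut_eq neg by simp
        then show ?thesis using \<delta> typeB_partitionsD(2)[OF C] m by (simp add: cut_def)
      qed
      show "\<gamma> = \<delta>" if "\<gamma> \<in> cut ` \<C>" "\<delta> \<in> cut ` \<C>" "x \<in> \<gamma>" "x \<in> \<delta>" for \<gamma> \<delta> x
        using that cut_inj by blast
    qed
    moreover have "\<beta> \<in> cut ` \<C>" using M(1) by (auto simp: \<beta>_def cut_def)
    moreover have "extend_block m \<beta> (cut \<gamma>) = \<gamma>" if \<gamma>: "\<gamma> \<in> \<C>" for \<gamma>
    proof -
      have "cut \<gamma> = \<beta> \<longleftrightarrow> m \<in> \<gamma>"
        using cut_eq[OF \<gamma> M(1)] mM[OF \<gamma>] M(2) by (auto simp: \<beta>_def cut_def)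
      moreover have "cut \<gamma> = uminus ` \<beta> \<longleftrightarrow> - m \<in> \<gamma>"
        using cut_eq[OF \<gamma> M'(1)] mM'[OF \<gamma>] M'(2) cut_neg[of M] by (auto simp: \<beta>_def cut_def)
      ultimately show ?thesis by (auto simp: extend_block_def cut_def)
    qed
    then have "extend_block m \<beta> ` cut ` \<C> = \<C>" by (simp add: image_image)
    then have "\<C> = insert_pair m (cut ` \<C>) \<beta>" using False by (simp add: insert_pair_def)
    ultimately show thesis using that by blast
  qed
qed

lemma bij_betw_insert_pair:
  assumes m: "m = int n + 1"
  shows "bij_betw (\<lambda>(\<B>, \<beta>). insert_pair m \<B> \<beta>)
    (SIGMA \<B>:typeB_partitions n. insert {} \<B>) (typeB_partitions (Suc n))"
  unfolding bij_betw_def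
proof
  let ?D = "SIGMA \<B>:typeB_partitions n. insert {} \<B>"
  show "inj_on (\<lambda>(\<B>, \<beta>). insert_pair m \<B> \<beta>) ?D"
  proof (rule inj_onI, clarify)
    fix \<B> \<beta> \<B>' \<beta>'
    assume B: "\<B> \<in> typeB_partitions n" "\<beta> \<in> insert {} \<B>"
      and B': "\<B>' \<in> typeB_partitions n" "\<beta>' \<in> insert {} \<B>'"
      and eq: "insert_pair m \<B> \<beta> = insert_pair m \<B>' \<beta>'"
    show "\<B> = \<B>' \<and> \<beta> = \<beta>'"
      using insert_pair_restrict[OF B(1) m B(2)] insert_pair_restrict[OF B'(1) m B'(2)]
        insert_pair_label[OF B(1) m B(2)] insert_pair_label[OF B'(1) m B'(2)]
      unfolding eq by (metis (no_types, lifting))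
  qed
  show "(\<lambda>(\<B>, \<beta>). insert_pair m \<B> \<beta>) ` ?D = typeB_partitions (Suc n)"
  proof (intro equalityI subsetI)
    fix \<C> assume "\<C> \<in> (\<lambda>(\<B>, \<beta>). insert_pair m \<B> \<beta>) ` ?D"
    then show "\<C> \<in> typeB_partitions (Suc n)"
      using insert_pair_empty_typeB[OF _ m] insert_pair_block_typeB[OF _ m] by auto
  next
    fix \<C> assume "\<C> \<in> typeB_partitions (Suc n)"
    then obtain \<B> \<beta> where "(\<B>, \<beta>) \<in> ?D" "\<C> = insert_pair m \<B> \<beta>"
      using insert_pair_surj[OF _ m] by (metis SigmaI)
    then show "\<C> \<in> (\<lambda>(\<B>, \<beta>). insert_pair m \<B> \<beta>) ` ?D" by force
  qed
qed

lemma typeB_partitions_0: "typeB_partitions 0 = {{{0}}}"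
proof -
  have "partition_on {0 :: int} \<B> \<longleftrightarrow> \<B> = {{0}}" for \<B>
  proof
    assume P: "partition_on {0} \<B>"
    have "\<beta> = {0}" if "\<beta> \<in> \<B>" for \<beta>
    proof -
      have "\<beta> \<subseteq> {0}" using partition_onD1[OF P] that by (metis Union_upper)
      moreover have "\<beta> \<noteq> {}" using partition_onD3[OF P] that by auto
      ultimately show ?thesis by (simp add: subset_singleton_iff)
    qed
    then have "\<B> \<subseteq> {{0}}" by (intro subsetI) simp
    moreover have "\<B> \<noteq> {}" using partition_onD1[OF P] by auto
    ultimately show "\<B> = {{0}}" by (simp add: subset_singleton_iff)
  qed (auto simp: partition_on_def disjoint_def)
  then have "\<B> \<in> typeB_partitions 0 \<longleftrightarrow> \<B> = {{0}}" for \<B>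
    unfolding typeB_partitions_iff by (simp cong: conj_cong)
  then show ?thesis by blast
qed

section \<open>Comparison of the two families\<close>

text \<open>Equality of the totals would not be enough for an induction, because the number of children
  depends on the statistic; the refined count is what the recurrence carries along.\<close>

lemma card_flat_fibre_eq_card_typeB_fibre:
  "finite (flat (stirling_perms (Suc n))) \<and>
    (\<forall>r. card {w \<in> flat (stirling_perms (Suc n)). card (inner_rl_mins w) = r} =
      card {\<B> \<in> typeB_partitions n. card \<B> = r})"
proof (induction n)
  case 0
  have "p \<in> inner_rl_mins [1, 1 :: nat] \<longleftrightarrow> p = 1" for p
    unfolding inner_rl_mins_def rl_min_def by (cases p) (auto simp: less_Suc_eq)
  then have "inner_rl_mins [1, 1 :: nat] = {1}" by blast
  then have "{w \<in> flat (stirling_perms (Suc 0)). card (inner_rl_mins w) = r} =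
      (if r = 1 then {[1, 1]} else {})" for r
    using flat_stirling_perms_1 by auto
  moreover have "{\<B> \<in> typeB_partitions 0. card \<B> = r} = (if r = 1 then {{{0}}} else {})" for r
    by (auto simp: typeB_partitions_0)
  ultimately show ?case using flat_stirling_perms_1 by simp
next
  case (Suc n)
  let ?F = "\<lambda>n. flat (stirling_perms (Suc n))" and ?s = "\<lambda>w. card (inner_rl_mins w)"
  have "finite (?F (Suc n)) \<and> card {w \<in> ?F (Suc n). ?s w = r} =
      r * card {w \<in> ?F n. ?s w = r} + card {w \<in> ?F n. ?s w + 2 = r}" for r
  proof (rule card_fibre_succession[OF _ bij_betw_insert_twice])
    fix w assume "w \<in> ?F n"
    then have w: "w \<noteq> []" "\<forall>x\<in>set w. x < Suc (Suc n)"
      using stirling_permsD[of w "Suc n"] by (auto simp: flat_def)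
    show "finite (inner_rl_mins w) \<and> ?s w = ?s w \<and> length w \<notin> inner_rl_mins w"
      by (auto simp: inner_rl_mins_def)
    show "?s (insert_twice (Suc (Suc n)) w (length w)) = ?s w + 2"
      using w by (subst card_inner_rl_mins_insert_twice) (auto simp: Suc_le_eq)
    show "?s (insert_twice (Suc (Suc n)) w p) = ?s w" if "p \<in> inner_rl_mins w" for p
      using w that by (subst card_inner_rl_mins_insert_twice) (auto simp: inner_rl_mins_def)
  qed (use Suc in auto)
  moreover have "card {\<B> \<in> typeB_partitions (Suc n). card \<B> = r} =
      r * card {\<B> \<in> typeB_partitions n. card \<B> = r} +
      card {\<B> \<in> typeB_partitions n. card \<B> + 2 = r}" for r
  proof (rule conjunct2[OF card_fibre_succession[OF finite_typeB_partitions bij_betw_insert_pair]])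
    fix \<B> assume B: "\<B> \<in> typeB_partitions n"
    show "finite \<B> \<and> card \<B> = card \<B> \<and> {} \<notin> \<B>"
      using finite_typeB_partition[OF B] typeB_partitionsD(4)[OF B] by blast
    show "card (insert_pair (int n + 1) \<B> {}) = card \<B> + 2"
      by (rule card_insert_pair_empty[OF B]) simp
    show "card (insert_pair (int n + 1) \<B> \<beta>) = card \<B>" if "\<beta> \<in> \<B>" for \<beta>
      by (rule card_insert_pair_block[OF B _ that]) simp
  qed simp
  moreover have "card {w \<in> ?F n. ?s w + 2 = r} = card {\<B> \<in> typeB_partitions n. card \<B> + 2 = r}" for r
  proof (cases "2 \<le> r")
    case True
    then have "k + 2 = r \<longleftrightarrow> k = r - 2" for k by linarith
    then show ?thesis using Suc.IH by simp
  next
    case False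
    then have "k + 2 \<noteq> r" for k by linarith
    then show ?thesis by simp
  qed
  ultimately show ?case using Suc.IH by simp
qed

theorem theorem1p1:
  fixes n :: nat
  assumes "n \<ge> 1"
  shows "\<exists>f. bij_betw f (flat (stirling_perms (n + 1))) (typeB_partitions n)"
proof (rule finite_same_card_bij)
  show "finite (flat (stirling_perms (n + 1)))"
    using card_flat_fibre_eq_card_typeB_fibre[of n] by simp
  then show "card (flat (stirling_perms (n + 1))) = card (typeB_partitions n)"
  proof (rule card_eq_if_fibres_card_eq[OF _ finite_typeB_partitions])
    show "card {w \<in> flat (stirling_perms (n + 1)). card (inner_rl_mins w) = r} =
        card {\<B> \<in> typeB_partitions n. card \<B> = r}" for r
      using card_flat_fibre_eq_card_typeB_fibre[of n] unfolding Suc_eq_plus1 by blast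
  qed
qed (rule finite_typeB_partitions)

end
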